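(* Let $p\ge 1$ be an integer, $m=p+1$, and let $t_n<t_{n+1}<\dots<t_{n+m}$ be arbitrary time levels. Then the method FBDF$p$+1 (the variable stepsize BDF$p$ step followed by the time filter defined in the context) is consistent of order $p+1$.
   Context: We consider numerical methods for $y'=f(t,y)$ with variable time levels $t_n<\dots<t_{n+m}$. Divided differences: $\delta^j\phi=\phi[t_{n+m},t_{n+m-1},\dots,t_{n+m-j}]$ is the $j$-th order Newton divided difference, written $\delta^j\phi=\sum_{i=m-j}^{m}c^{(j)}_i\phi_{n+i}$, which defines the coefficients $c^{(j)}_i$. $\delta^j y^p$ means the same expression applied to $y_n,\dots,y_{n+m-1}$ and with the last value replaced by $y^p_{n+m}$. Empty products equal $1$. FBDF$p$+1 (with $m=p+1$): given $y_n,\dots,y_{n+m-1}$, find $y^p_{n+m}$ and then $y_{n+m}$ from $$\sum_{j=1}^{p}\Big[\prod_{i=1}^{j-1}(t_{n+m}-t_{n+m-i})\Big]\delta^j y^p=f(t_{n+m},y^p_{n+m}),\qquad y_{n+m}=y^p_{n+m}-\eta^{(p+1)}\delta^{p+1}y^p,$$ $$\eta^{(p+1)}=\frac{\prod_{i=1}^{p}(t_{n+m}-t_{n+m-i})}{\sum_{j=1}^{p+1}(t_{n+m}-t_{n+m-j})^{-1}}.$$ Eliminating $y^p_{n+m}$, this method is equivalent to the one-leg method $$\sum_{j=1}^{p+1}\Big[\prod_{i=1}^{j-1}(t_{n+m}-t_{n+m-i})\Big]\delta^j y=f\Big(t_{n+m},\,y_{n+m}+\frac{\eta^{(p+1)}}{1-\eta^{(p+1)}c^{(p+1)}_m}\delta^{p+1}y\Big).$$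 An $m$-step one-leg method is a method of the form $$\sum_{i=0}^m\bar\alpha_i y_{n+i}=f\Big(\sum_{i=0}^m\beta_i t_{n+i},\sum_{i=0}^m\beta_i y_{n+i}\Big),$$ where $\bar\alpha_i,\beta_i$ may depend on the time levels. For FBDF$p$+1 the coefficients $\bar\alpha_i$ and $\beta_i$ are read off from the left-hand side and from the second argument of $f$ in the equivalent one-leg method above (and then $\sum_i\beta_i t_{n+i}=t_{n+m}$). Order of consistency of a one-leg method: with $t^*=\sum_{i=0}^m\beta_i t_{n+i}$, define the differentiation and interpolation error operators $$(L_d\phi)(t^* )=\sum_{i=0}^m\bar\alpha_i\phi(t_{n+i})-\phi'(t^* ),\qquad (L_i\phi)(t^* )=\sum_{i=0}^m\beta_i\phi(t_{n+i})-\phi(t^* ).$$ Let $p_d$ (resp. $p_i$) be the largest integer such that $L_d\phi$ (resp. $L_i\phi$) is zero for all polynomials $\phi$ of degree at most $p_d$ (resp. $p_i$). The order of the one-leg method is $\min(p_d,p_i+1)$. *)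

theory Defs
  imports "HOL-Analysis.Analysis" "HOL-Computational_Algebra.Polynomial"
begin

text \<open>
  All definitions refer to one step of an \<open>m\<close>-step method and use local indices: \<open>t i\<close> and \<open>y i\<close>
  with \<open>i \<le> m\<close> stand for the paper's \<open>t\<^sub>n\<^sub>+\<^sub>i\<close> and \<open>y\<^sub>n\<^sub>+\<^sub>i\<close>.
\<close>

section \<open>Divided differences\<close>

text \<open>\<open>divdiff t \<phi> l j\<close> is the Newton divided difference of \<open>\<phi>\<close> on the nodes \<open>t l, \<dots>, t (l + j)\<close>.\<close>

fun divdiff :: "(nat \<Rightarrow> real) \<Rightarrow> (nat \<Rightarrow> 'a::real_vector) \<Rightarrow> nat \<Rightarrow> nat \<Rightarrow> 'a" where
  "divdiff t \<phi> l 0 = \<phi> l"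
| "divdiff t \<phi> l (Suc j) = (divdiff t \<phi> (Suc l) j - divdiff t \<phi> l j) /\<^sub>R (t (l + Suc j) - t l)"

text \<open>\<open>\<delta>\<^sup>j\<phi>\<close> on the nodes \<open>t m, t (m - 1), \<dots>, t (m - j)\<close>; only used for \<open>j \<le> m\<close>.\<close>

definition delta :: "nat \<Rightarrow> (nat \<Rightarrow> real) \<Rightarrow> nat \<Rightarrow> (nat \<Rightarrow> 'a::real_vector) \<Rightarrow> 'a" where
  "delta m t j \<phi> = divdiff t \<phi> (m - j) j"

text \<open>
  The coefficient of \<open>\<phi> i\<close> in \<open>\<delta>\<^sup>j\<phi>\<close>, obtained as the value of \<open>\<delta>\<^sup>j\<close> on the \<open>i\<close>-th unit sequence;
  it vanishes for \<open>i < m - j\<close>. See \<open>delta_eq_sum_coeff\<close> for the expansion of \<open>\<delta>\<^sup>j\<phi>\<close>.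
\<close>

definition delta_coeff :: "nat \<Rightarrow> (nat \<Rightarrow> real) \<Rightarrow> nat \<Rightarrow> nat \<Rightarrow> real" where
  "delta_coeff m t j i = delta m t j (\<lambda>k. if k = i then 1 else 0)"

section \<open>The filtered BDF method\<close>

definition fbdf_eta :: "nat \<Rightarrow> (nat \<Rightarrow> real) \<Rightarrow> real" where
  "fbdf_eta p t = (let m = p + 1 in
     (\<Prod>i=1..p. t m - t (m - i)) / (\<Sum>j=1..p+1. inverse (t m - t (m - j))))"

text \<open>
  One step of FBDF\<open>p\<close>+1: \<open>yp\<close> is the BDF\<open>p\<close> value, and \<open>y(m := yp)\<close> is the sequence in which
  \<open>y m\<close> is replaced by \<open>yp\<close>.
\<close>

definition fbdf_step ::
  "nat \<Rightarrow> (nat \<Rightarrow> real) \<Rightarrow> (real \<Rightarrow> 'a \<Rightarrow> 'a) \<Rightarrow> (nat \<Rightarrow> 'a::real_vector) \<Rightarrow> 'a \<Rightarrow> bool" where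
  "fbdf_step p t f y yp \<longleftrightarrow> (let m = p + 1 in
     (\<Sum>j=1..p. (\<Prod>i=1..j-1. t m - t (m - i)) *\<^sub>R delta m t j (y(m := yp))) = f (t m) yp \<and>
     y m = yp - fbdf_eta p t *\<^sub>R delta m t (p+1) (y(m := yp)))"

text \<open>
  Coefficients of the one-leg form of FBDF\<open>p\<close>+1, which is
  \[\sum_{j=1}^{p+1}\Big[\prod_{i=1}^{j-1}(t_m-t_{m-i})\Big]\delta^j y
     = f\Big(t_m,\, y_m+\frac{\eta}{1-\eta\, c^{(p+1)}_m}\,\delta^{p+1}y\Big).\]
  The lemma \<open>fbdf_step_iff_one_leg_step\<close> below shows the equivalence with \<open>fbdf_step\<close>.
\<close>

definition fbdf_alpha :: "nat \<Rightarrow> (nat \<Rightarrow> real) \<Rightarrow> nat \<Rightarrow> real" where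
  "fbdf_alpha p t k = (let m = p + 1 in
     \<Sum>j=1..p+1. (\<Prod>i=1..j-1. t m - t (m - i)) * delta_coeff m t j k)"

definition fbdf_beta :: "nat \<Rightarrow> (nat \<Rightarrow> real) \<Rightarrow> nat \<Rightarrow> real" where
  "fbdf_beta p t k = (let m = p + 1; \<eta> = fbdf_eta p t in
     (if k = m then 1 else 0) + \<eta> / (1 - \<eta> * delta_coeff m t (p+1) m) * delta_coeff m t (p+1) k)"

section \<open>One-leg methods and their order of consistency\<close>

definition one_leg_step ::
  "nat \<Rightarrow> (nat \<Rightarrow> real) \<Rightarrow> (nat \<Rightarrow> real) \<Rightarrow> (nat \<Rightarrow> real) \<Rightarrow> (real \<Rightarrow> 'a \<Rightarrow> 'a) \<Rightarrow>
   (nat \<Rightarrow> 'a::real_vector) \<Rightarrow> bool" where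
  "one_leg_step m \<alpha> \<beta> t f y \<longleftrightarrow>
     (\<Sum>i=0..m. \<alpha> i *\<^sub>R y i) = f (\<Sum>i=0..m. \<beta> i * t i) (\<Sum>i=0..m. \<beta> i *\<^sub>R y i)"

definition diff_error ::
  "nat \<Rightarrow> (nat \<Rightarrow> real) \<Rightarrow> (nat \<Rightarrow> real) \<Rightarrow> (nat \<Rightarrow> real) \<Rightarrow> (real \<Rightarrow> real) \<Rightarrow> real" where
  "diff_error m \<alpha> \<beta> t \<phi> =
     (\<Sum>i=0..m. \<alpha> i * \<phi> (t i)) - deriv \<phi> (\<Sum>i=0..m. \<beta> i * t i)"

definition interp_error ::
  "nat \<Rightarrow> (nat \<Rightarrow> real) \<Rightarrow> (nat \<Rightarrow> real) \<Rightarrow> (real \<Rightarrow> real) \<Rightarrow> real" where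
  "interp_error m \<beta> t \<phi> =
     (\<Sum>i=0..m. \<beta> i * \<phi> (t i)) - \<phi> (\<Sum>i=0..m. \<beta> i * t i)"

definition vanishes_upto :: "((real \<Rightarrow> real) \<Rightarrow> real) \<Rightarrow> int \<Rightarrow> bool" where
  "vanishes_upto L d \<longleftrightarrow> (\<forall>q :: real poly. int (degree q) \<le> d \<longrightarrow> L (poly q) = 0)"

text \<open>\<open>d\<close> is the largest integer with \<open>vanishes_upto L d\<close>; it is \<open>-1\<close> if \<open>L\<close> is nonzero on some
  constant, and there is none if \<open>L\<close> vanishes on all polynomials.\<close>

definition exactness_degree :: "((real \<Rightarrow> real) \<Rightarrow> real) \<Rightarrow> int \<Rightarrow> bool" where
  "exactness_degree L d \<longleftrightarrow> vanishes_upto L d \<and> (\<forall>d'. vanishes_upto L d' \<longrightarrow> d' \<le> d)"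

definition one_leg_order ::
  "nat \<Rightarrow> (nat \<Rightarrow> real) \<Rightarrow> (nat \<Rightarrow> real) \<Rightarrow> (nat \<Rightarrow> real) \<Rightarrow> int \<Rightarrow> bool" where
  "one_leg_order m \<alpha> \<beta> t r \<longleftrightarrow>
     (\<exists>pd pi. exactness_degree (diff_error m \<alpha> \<beta> t) pd \<and>
              exactness_degree (interp_error m \<beta> t) pi \<and>
              r = min pd (pi + 1))"

section \<open>The coefficients above are those of the method\<close>

lemma divdiff_expand:
  assumes "l + j \<le> m"
  shows "divdiff t \<phi> l j = (\<Sum>i=0..m. divdiff t (\<lambda>k. if k = i then 1 else 0) l j *\<^sub>R \<phi> i)"
  using assms
proof (induction j arbitrary: l)
  case 0
  have "(\<Sum>i=0..m. (if l = i then 1 else 0) *\<^sub>R \<phi> i) = (\<Sum>i\<in>{0..m}. if l = i then \<phi> i else 0)"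
    by (intro sum.cong) auto
  then show ?case using 0 by simp
next
  case (Suc j)
  show ?case
    using Suc.IH[of l] Suc.IH[of "Suc l"] Suc.prems
    by (simp add: scaleR_sum_right sum_subtractf[symmetric] algebra_simps)
qed

lemma divdiff_unit_outside:
  assumes "i < l \<or> l + j < i"
  shows "divdiff t (\<lambda>k. if k = i then 1 else (0::real)) l j = 0"
  using assms by (induction j arbitrary: l) auto

lemma delta_eq_sum_coeff:
  assumes "j \<le> m"
  shows "delta m t j \<phi> = (\<Sum>i=m-j..m. delta_coeff m t j i *\<^sub>R \<phi> i)"
proof -
  have "delta m t j \<phi> = (\<Sum>i=0..m. delta_coeff m t j i *\<^sub>R \<phi> i)"
    unfolding delta_def delta_coeff_def using assms by (intro divdiff_expand) simp
  also have "\<dots> = (\<Sum>i=m-j..m. delta_coeff m t j i *\<^sub>R \<phi> i)"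
    by (rule sum.mono_neutral_right)
       (auto simp: delta_coeff_def delta_def divdiff_unit_outside)
  finally show ?thesis .
qed

lemma delta_eq_sum_coeff0:
  assumes "j \<le> m"
  shows "delta m t j \<phi> = (\<Sum>i=0..m. delta_coeff m t j i *\<^sub>R \<phi> i)"
  unfolding delta_def delta_coeff_def using assms by (intro divdiff_expand) simp

lemma divdiff_unit_last:
  "divdiff t (\<lambda>k. if k = l + j then 1 else (0::real)) l j = inverse (\<Prod>i=1..j. t (l + j) - t (l + j - i))"
proof (induction j arbitrary: l)
  case 0
  then show ?case by simp
next
  case (Suc j)
  show ?case
    using Suc.IH[of "Suc l"] divdiff_unit_outside[of "l + Suc j" l j t]
    by simp
qed

lemma delta_coeff_last:
  assumes "j \<le> m"
  shows "delta_coeff m t j m = inverse (\<Prod>i=1..j. t m - t (m - i))"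
  using divdiff_unit_last[of t "m - j" j] assms by (simp add: delta_coeff_def delta_def)

lemma delta_nodes_zero:
  assumes "2 \<le> j" "j \<le> m" and mono: "strict_mono_on {0..m} t"
  shows "delta m t j t = 0"
proof -
  have one: "divdiff t t l (Suc 0) = 1" if "l < m" for l
    using strict_mono_onD[OF mono, of l "Suc l"] that by simp
  have "divdiff t t l (Suc (Suc k)) = 0" if "l + Suc (Suc k) \<le> m" for l k
    using that
  proof (induction k arbitrary: l)
    case 0
    then show ?case using one[of l] one[of "Suc l"] by (subst divdiff.simps(2)) simp
  next
    case (Suc k)
    have "divdiff t t l (Suc (Suc k)) = 0" "divdiff t t (Suc l) (Suc (Suc k)) = 0"
      using Suc.IH[of l] Suc.IH[of "Suc l"] Suc.prems by (simp_all del: divdiff.simps)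
    then show ?case by (simp only: divdiff.simps(2)[of _ _ _ "Suc (Suc k)"]) simp
  qed
  from this[of "m - j" "j - 2"] show ?thesis
    using assms by (simp add: delta_def numeral_2_eq_2 Suc_diff_Suc del: divdiff.simps)
qed

lemma fbdf_alpha_sum:
  fixes y :: "nat \<Rightarrow> 'a::real_vector"
  assumes m: "m = p + 1"
  shows "(\<Sum>i=0..m. fbdf_alpha p t i *\<^sub>R y i) =
         (\<Sum>j=1..p+1. (\<Prod>i=1..j-1. t m - t (m - i)) *\<^sub>R delta m t j y)"
proof -
  have "(\<Sum>i=0..m. fbdf_alpha p t i *\<^sub>R y i) =
        (\<Sum>k=0..m. \<Sum>j=1..p+1. ((\<Prod>i=1..j-1. t m - t (m - i)) * delta_coeff m t j k) *\<^sub>R y k)"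
    by (simp only: fbdf_alpha_def Let_def scaleR_sum_left m)
  also have "\<dots> = (\<Sum>j=1..p+1. \<Sum>k=0..m. ((\<Prod>i=1..j-1. t m - t (m - i)) * delta_coeff m t j k) *\<^sub>R y k)"
    by (rule sum.swap)
  also have "\<dots> = (\<Sum>j=1..p+1. (\<Prod>i=1..j-1. t m - t (m - i)) *\<^sub>R delta m t j y)"
  proof (intro sum.cong refl)
    fix j assume "j \<in> {1..p+1}"
    then have "j \<le> m" by (simp add: m)
    then show "(\<Sum>k=0..m. ((\<Prod>i=1..j-1. t m - t (m - i)) * delta_coeff m t j k) *\<^sub>R y k) =
          (\<Prod>i=1..j-1. t m - t (m - i)) *\<^sub>R delta m t j y"
      by (simp add: delta_eq_sum_coeff0 scaleR_sum_right)
  qed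
  finally show ?thesis .
qed

lemma fbdf_beta_sum:
  fixes y :: "nat \<Rightarrow> 'a::real_vector"
  assumes m: "m = p + 1" and \<eta>: "\<eta> = fbdf_eta p t"
  shows "(\<Sum>i=0..m. fbdf_beta p t i *\<^sub>R y i) =
         y m + (\<eta> / (1 - \<eta> * delta_coeff m t (p+1) m)) *\<^sub>R delta m t (p+1) y"
proof -
  have "(\<Sum>i=0..m. (if i = m then 1 else 0) *\<^sub>R y i) = (\<Sum>i\<in>{0..m}. if i = m then y i else 0)"
    by (intro sum.cong) auto
  also have "\<dots> = y m"
    by (simp add: sum.delta)
  finally have *: "(\<Sum>i=0..m. (if i = m then 1 else 0) *\<^sub>R y i) = y m" .
  show ?thesis
    unfolding fbdf_beta_def Let_def m[symmetric] \<eta>[symmetric] scaleR_left_distrib sum.distrib *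
    by (simp add: delta_eq_sum_coeff0 scaleR_sum_right)
qed

lemma fbdf_beta_nodes:
  assumes m: "m = p + 1" and p: "p \<ge> 1" and mono: "strict_mono_on {0..m} t"
  shows "(\<Sum>i=0..m. fbdf_beta p t i * t i) = t m"
  using fbdf_beta_sum[OF m refl, of t t] delta_nodes_zero[OF _ _ mono, of m] m p by simp

lemma fbdf_step_iff_one_leg_step:
  fixes y :: "nat \<Rightarrow> 'a::real_vector"
  assumes p: "p \<ge> 1" and mono: "strict_mono_on {0..p+1} t"
  shows "(\<exists>yp. fbdf_step p t f y yp) \<longleftrightarrow>
         one_leg_step (p+1) (fbdf_alpha p t) (fbdf_beta p t) t f y"
proof -
  define m where "m = p + 1"
  define \<eta> where "\<eta> = fbdf_eta p t"
  define c where "c = delta_coeff m t (p+1) m"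
  define P where "P j = (\<Prod>i=1..j. t m - t (m - i))" for j
  define S where "S k = (\<Sum>j=1..k. inverse (t m - t (m - j)))" for k
  have gap: "t m - t (m - i) > 0" if "i \<in> {1..m}" for i
    using strict_mono_onD[OF mono, of "m - i" m] that by (auto simp: m_def)
  have Ppos: "P j > 0" if "j \<le> m" for j
    unfolding P_def using that gap by (intro prod_pos) auto
  have PS: "P (Suc j) = P j * (t m - t (m - Suc j))" for j
    by (simp add: P_def)
  have Spos: "S k > 0" if "1 \<le> k" "k \<le> m" for k
    unfolding S_def using that gap by (intro sum_pos) auto
  have Sm: "S m = S p + inverse (t m - t 0)"
    by (simp add: S_def m_def)
  have c: "c = inverse (P m)"
    unfolding c_def P_def by (simp add: delta_coeff_last m_def)
  have Pm: "P m = P p * (t m - t 0)"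
    using PS[of p] by (simp add: m_def)
  have \<eta>: "\<eta> = P p / S m"
    unfolding \<eta>_def P_def S_def fbdf_eta_def Let_def m_def by simp
  have pos: "P p > 0" "S p > 0" "S m > 0" "t m - t 0 > 0"
    using Ppos[of p] Spos[of p] Spos[of m] gap[of m] p by (auto simp: m_def)
  have "\<eta> * c = inverse (t m - t 0) / S m"
    using pos unfolding \<eta> c Pm by (simp add: field_simps)
  moreover have "S p = S m - inverse (t m - t 0)"
    using Sm by simp
  ultimately have \<eta>c: "1 - \<eta> * c = S p / S m"
    using pos by (simp add: diff_divide_distrib)
  have nz: "1 - \<eta> * c \<noteq> 0"
    using pos \<eta>c by simp
  have frac: "\<eta> / (1 - \<eta> * c) * S p = P p"
    unfolding \<eta>c using pos by (simp add: \<eta>)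
  have upd: "delta m t j (y(m := z)) = delta m t j y + delta_coeff m t j m *\<^sub>R (z - y m)"
    if "j \<le> m" for j z
  proof -
    have "delta m t j (y(m := z)) - delta m t j y
        = (\<Sum>i=0..m. delta_coeff m t j i *\<^sub>R ((y(m := z)) i - y i))"
      using that by (simp only: delta_eq_sum_coeff0 sum_subtractf scaleR_diff_right)
    also have "\<dots> = (\<Sum>i\<in>{0..m}. if i = m then delta_coeff m t j i *\<^sub>R (z - y m) else 0)"
      by (intro sum.cong) auto
    also have "\<dots> = delta_coeff m t j m *\<^sub>R (z - y m)"
      by (simp add: sum.delta)
    finally show ?thesis by (simp add: algebra_simps)
  qed
  define z where "z = y m + (\<eta> / (1 - \<eta> * c)) *\<^sub>R delta m t m y"
  have filt: "y m = yp - \<eta> *\<^sub>R delta m t m (y(m := yp)) \<longleftrightarrow> yp = z" for yp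
  proof -
    have upd_m: "delta m t m (y(m := yp)) = delta m t m y + c *\<^sub>R (yp - y m)"
      unfolding c_def m_def[symmetric] by (rule upd) simp
    have "y m = yp - \<eta> *\<^sub>R delta m t m (y(m := yp)) \<longleftrightarrow>
          (1 - \<eta> * c) *\<^sub>R (yp - y m) = \<eta> *\<^sub>R delta m t m y"
      unfolding upd_m by (auto simp: algebra_simps)
    also have "\<dots> \<longleftrightarrow> yp - y m = (\<eta> / (1 - \<eta> * c)) *\<^sub>R delta m t m y"
    proof
      assume *: "(1 - \<eta> * c) *\<^sub>R (yp - y m) = \<eta> *\<^sub>R delta m t m y"
      have "yp - y m = inverse (1 - \<eta> * c) *\<^sub>R ((1 - \<eta> * c) *\<^sub>R (yp - y m))"
        using nz by simp
      then show "yp - y m = (\<eta> / (1 - \<eta> * c)) *\<^sub>R delta m t m y"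
        unfolding * by (simp add: divide_inverse mult.commute)
    qed (use nz in simp)
    finally show ?thesis by (auto simp: z_def algebra_simps)
  qed
  have last: "P (j - 1) * delta_coeff m t j m = inverse (t m - t (m - j))" if "j \<in> {1..p}" for j
  proof -
    have "delta_coeff m t j m = inverse (P j)"
      using that by (simp add: delta_coeff_last P_def m_def)
    moreover have "P j = P (j - 1) * (t m - t (m - j))"
      using PS[of "j - 1"] that by simp
    moreover have "P (j - 1) > 0"
      using that by (intro Ppos) (auto simp: m_def)
    ultimately show ?thesis by simp
  qed
  have split_last: "(\<Sum>j=1..p+1. P (j - 1) *\<^sub>R delta m t j y) =
      (\<Sum>j=1..p. P (j - 1) *\<^sub>R delta m t j y) + P p *\<^sub>R delta m t m y"
    by (simp add: m_def)
  have "(\<Sum>j=1..p. P (j - 1) *\<^sub>R delta m t j (y(m := z)))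
      = (\<Sum>j=1..p. P (j - 1) *\<^sub>R delta m t j y + inverse (t m - t (m - j)) *\<^sub>R (z - y m))"
  proof (intro sum.cong refl)
    fix j assume j: "j \<in> {1..p}"
    then have "j \<le> m" by (simp add: m_def)
    then show "P (j - 1) *\<^sub>R delta m t j (y(m := z)) =
          P (j - 1) *\<^sub>R delta m t j y + inverse (t m - t (m - j)) *\<^sub>R (z - y m)"
      using last[OF j] by (simp add: upd scaleR_right_distrib)
  qed
  also have "\<dots> = (\<Sum>j=1..p. P (j - 1) *\<^sub>R delta m t j y) + S p *\<^sub>R (z - y m)"
    by (simp add: sum.distrib S_def scaleR_sum_left)
  also have "S p *\<^sub>R (z - y m) = P p *\<^sub>R delta m t m y"
    using frac by (simp add: z_def mult.commute)
  finally have bdf: "(\<Sum>j=1..p. P (j - 1) *\<^sub>R delta m t j (y(m := z)))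
      = (\<Sum>j=1..p+1. P (j - 1) *\<^sub>R delta m t j y)"
    by (simp only: split_last)
  have "(\<exists>yp. fbdf_step p t f y yp) \<longleftrightarrow>
        (\<exists>yp. (\<Sum>j=1..p. P (j - 1) *\<^sub>R delta m t j (y(m := yp))) = f (t m) yp \<and> yp = z)"
    unfolding fbdf_step_def Let_def m_def[symmetric] \<eta>_def[symmetric] filt P_def ..
  also have "\<dots> \<longleftrightarrow> (\<Sum>j=1..p+1. P (j - 1) *\<^sub>R delta m t j y) = f (t m) z"
    using bdf by auto
  also have "\<dots> \<longleftrightarrow> one_leg_step m (fbdf_alpha p t) (fbdf_beta p t) t f y"
    unfolding one_leg_step_def fbdf_alpha_sum[OF m_def] fbdf_beta_sum[OF m_def \<eta>_def]
      fbdf_beta_nodes[OF m_def p mono[folded m_def]] z_def c_def P_def m_def[symmetric] ..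
  finally show ?thesis by (simp add: m_def)
qed

end

theory Submission
  imports Defs
begin

text \<open>
  On polynomials of degree at most \<open>j\<close>, \<open>\<delta>\<^sup>j\<close> reads off the coefficient of degree \<open>j\<close>. Hence, for the
  Newton basis \<open>N\<^sub>k = (x - t\<^sub>m) \<cdots> (x - t\<^sub>m\<^sub>-\<^sub>k\<^sub>+\<^sub>1)\<close>, \<open>\<delta>\<^sup>j N\<^sub>k\<close> is \<open>1\<close> if \<open>j = k\<close> and \<open>0\<close> otherwise, and
  the differentiation formula, which is the derivative at \<open>t\<^sub>m\<close> of the Newton interpolant, is exact
  on degree at most \<open>m\<close>. It fails on \<open>N\<^sub>m\<^sub>+\<^sub>1\<close>, which vanishes at all nodes but has a simple root at
  \<open>t\<^sub>m\<close>, so \<open>p\<^sub>d = m\<close>. The interpolation error is a nonzero multiple of \<open>\<delta>\<^sup>m\<close>, so \<open>p\<^sub>i = m - 1 = p\<close>.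
\<close>

section \<open>Divided differences of polynomials\<close>

lemma divdiff_const: "divdiff t (\<lambda>_. c) l j = (if j = 0 then c else 0)"
  by (induction j arbitrary: l) auto

lemma divdiff_add: "divdiff t (\<lambda>i. f i + g i) l j = divdiff t f l j + divdiff t g l j"
  by (induction j arbitrary: l) (simp_all add: algebra_simps)

lemma divdiff_eq_0:
  assumes "\<And>i. l \<le> i \<Longrightarrow> i \<le> l + j \<Longrightarrow> f i = 0"
  shows "divdiff t f l j = 0"
  using assms by (induction j arbitrary: l) auto

text \<open>Leibniz rule with the identity as one factor: only its value at the first node and its
  first divided difference, which is \<open>1\<close>, contribute. This drives the induction over
  \<open>pCons a q\<close>.\<close>

lemma divdiff_times_node:
  fixes g :: "nat \<Rightarrow> real"
  assumes "inj_on t {l..l + Suc j}"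
  shows "divdiff t (\<lambda>i. t i * g i) l (Suc j) = t l * divdiff t g l (Suc j) + divdiff t g (Suc l) j"
  using assms
proof (induction j arbitrary: l)
  case 0
  then have "t (Suc l) \<noteq> t l"
    by (auto dest: inj_onD)
  then show ?case by (simp add: field_simps)
next
  case (Suc j)
  let ?A = "divdiff t g" and ?X = "divdiff t (\<lambda>i. t i * g i)"
  have ne: "t (l + Suc (Suc j)) - t l \<noteq> 0" "t (l + Suc (Suc j)) - t (Suc l) \<noteq> 0"
    using inj_onD[OF Suc.prems, of "l + Suc (Suc j)" l]
      inj_onD[OF Suc.prems, of "l + Suc (Suc j)" "Suc l"] by auto
  have inj: "inj_on t {l..l + Suc j}" "inj_on t {Suc l..Suc l + Suc j}"
    using Suc.prems by (auto intro: inj_on_subset)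
  have A1: "(t (l + Suc (Suc j)) - t l) * ?A l (Suc (Suc j)) = ?A (Suc l) (Suc j) - ?A l (Suc j)"
    by (subst divdiff.simps(2)) (use ne in simp)
  have A2: "(t (l + Suc (Suc j)) - t (Suc l)) * ?A (Suc l) (Suc j)
      = ?A (Suc (Suc l)) j - ?A (Suc l) j"
    by (subst divdiff.simps(2)) (use ne in simp)
  \<comment> \<open>Multiplying by the outer gap avoids division. \<open>A2\<close> merges the two
    terms of order \<open>j\<close>, and \<open>A1\<close> then produces the term of order
    \<open>Suc (Suc j)\<close>.\<close>
  have "(t (l + Suc (Suc j)) - t l) * ?X l (Suc (Suc j)) = ?X (Suc l) (Suc j) - ?X l (Suc j)"
    by (subst divdiff.simps(2)) (use ne in simp)
  also have "\<dots> = t (Suc l) * ?A (Suc l) (Suc j) + ?A (Suc (Suc l)) j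
      - (t l * ?A l (Suc j) + ?A (Suc l) j)"
    by (simp only: Suc.IH[OF inj(1)] Suc.IH[OF inj(2)])
  also have "\<dots> = (t (l + Suc (Suc j)) - t l) * (t l * ?A l (Suc (Suc j)) + ?A (Suc l) (Suc j))"
    using A1 A2 by algebra
  finally show ?case
    using ne(1) mult_left_cancel by blast
qed

lemma divdiff_poly:
  fixes q :: "real poly"
  assumes "inj_on t {l..l + j}" "degree q \<le> j"
  shows "divdiff t (\<lambda>i. poly q (t i)) l j = coeff q j"
  using assms
proof (induction q arbitrary: l j)
  case 0
  then show ?case by (simp add: divdiff_const)
next
  case (pCons a q)
  show ?case
  proof (cases j)
    case 0
    with pCons.prems have "q = 0" by (auto split: if_splits)
    with 0 show ?thesis by simp
  next
    case (Suc k)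
    have deg: "degree q \<le> k"
      using pCons.prems Suc by (auto split: if_splits)
    have inj: "inj_on t {l..l + Suc k}" "inj_on t {Suc l..Suc l + k}"
      using pCons.prems Suc by (auto intro: inj_on_subset)
    have "divdiff t (\<lambda>i. poly (pCons a q) (t i)) l (Suc k)
        = t l * divdiff t (\<lambda>i. poly q (t i)) l (Suc k) + divdiff t (\<lambda>i. poly q (t i)) (Suc l) k"
      by (simp only: poly_pCons divdiff_add divdiff_const divdiff_times_node[OF inj(1)]) simp
    \<comment> \<open>The first term vanishes by degree; \<open>coeff q k\<close> is the coefficient
      of \<open>pCons a q\<close> at \<open>Suc k\<close>.\<close>
    also have "\<dots> = t l * coeff q (Suc k) + coeff q k"
      using pCons.IH[OF inj(1)] pCons.IH[OF inj(2) deg] deg by (simp del: divdiff.simps)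
    finally show ?thesis
      using deg Suc by (simp add: coeff_eq_0 del: divdiff.simps)
  qed
qed

lemma delta_poly:
  fixes q :: "real poly"
  assumes "inj_on t {0..m}" "j \<le> m" "degree q \<le> j"
  shows "delta m t j (\<lambda>i. poly q (t i)) = coeff q j"
  unfolding delta_def
  by (rule divdiff_poly) (use assms in \<open>auto intro: inj_on_subset\<close>)

section \<open>The Newton basis\<close>

definition newton_poly :: "nat \<Rightarrow> (nat \<Rightarrow> real) \<Rightarrow> nat \<Rightarrow> real poly" where
  "newton_poly m t k = (\<Prod>i<k. [:- t (m - i), 1:])"

lemma newton_poly_0 [simp]: "newton_poly m t 0 = 1"
  and newton_poly_Suc: "newton_poly m t (Suc k) = newton_poly m t k * [:- t (m - k), 1:]"
  by (simp_all add: newton_poly_def)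

lemma monic_newton_poly:
  shows degree_newton_poly: "degree (newton_poly m t k) = k"
    and coeff_newton_poly: "coeff (newton_poly m t k) k = 1"
proof -
  have "degree (newton_poly m t k) = k \<and> lead_coeff (newton_poly m t k) = 1"
  proof (induction k)
    case (Suc k)
    then have "newton_poly m t k \<noteq> 0" by auto
    with Suc have "degree (newton_poly m t (Suc k)) = Suc k"
      by (simp add: newton_poly_Suc degree_mult_eq del: mult_pCons_right)
    moreover have "lead_coeff (newton_poly m t (Suc k)) = 1"
      unfolding newton_poly_Suc lead_coeff_mult conjunct2[OF Suc] by simp
    ultimately show ?case ..
  qed simp
  then have deg: "degree (newton_poly m t k) = k" and lc: "lead_coeff (newton_poly m t k) = 1"
    by auto
  show "degree (newton_poly m t k) = k" "coeff (newton_poly m t k) k = 1"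
    using deg lc unfolding deg by simp_all
qed

lemma newton_poly_node:
  assumes "i \<le> m" "m < i + k"
  shows "poly (newton_poly m t k) (t i) = 0"
  unfolding newton_poly_def poly_prod
  \<comment> \<open>The factor of index \<open>m - i\<close> has the root \<open>t i\<close>, and
    \<open>m < i + k\<close> puts this index below \<open>k\<close>.\<close>
  by (rule prod_zero) (use assms in \<open>auto intro!: bexI[of _ "m - i"]\<close>)

text \<open>At \<open>t m\<close> only the product-rule term that differentiates the factor with
  root \<open>t m\<close> survives. The result is the weight of the difference of order
  \<open>Suc k\<close> in the method.\<close>

lemma pderiv_newton_poly_last:
  "poly (pderiv (newton_poly m t (Suc k))) (t m) = (\<Prod>i=1..k. t m - t (m - i))"
proof (induction k)
  case (Suc k)
  have "poly (newton_poly m t (Suc k)) (t m) = 0"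
    by (simp add: newton_poly_node)
  with Suc show ?case
    by (simp add: newton_poly_Suc[of _ _ "Suc k"] pderiv_mult pderiv_pCons algebra_simps
        del: mult_pCons_right)
qed (simp add: newton_poly_Suc pderiv_pCons)

text \<open>For \<open>k \<le> j\<close> this reads off a coefficient of a monic polynomial of
  degree \<open>k\<close>. For \<open>k > j\<close> all nodes of the difference are roots, since the
  basis takes its nodes from \<open>t m\<close> backwards, as \<open>delta\<close> does.\<close>

lemma delta_newton_poly:
  assumes "inj_on t {0..m}" "j \<le> m"
  shows "delta m t j (\<lambda>i. poly (newton_poly m t k) (t i)) = (if j = k then 1 else 0)"
proof (cases "k \<le> j")
  case True
  then show ?thesis
    using assms by (auto simp: delta_poly degree_newton_poly coeff_newton_poly coeff_eq_0)
next
  case False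
  then show ?thesis
    using assms unfolding delta_def by (subst divdiff_eq_0) (auto simp: newton_poly_node)
qed

text \<open>Subtracting the right multiple of the monic \<open>newton_poly m t d\<close> lowers the
  degree bound, so agreement on the basis suffices.\<close>

lemma linear_functional_newton_eq:
  fixes L M :: "real poly \<Rightarrow> real"
  assumes add: "\<And>q r. L (q + r) = L q + L r" "\<And>q r. M (q + r) = M q + M r"
    and smult: "\<And>c q. L (smult c q) = c * L q" "\<And>c q. M (smult c q) = c * M q"
    and basis: "\<And>k. k \<le> d \<Longrightarrow> L (newton_poly m t k) = M (newton_poly m t k)"
    and deg: "degree q \<le> d"
  shows "L q = M q"
  using deg basis
proof (induction d arbitrary: q)
  case 0
  then obtain c where q: "q = smult c (newton_poly m t 0)"
    by (auto elim: degree_eq_zeroE)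
  show ?case unfolding q smult using 0(2)[of 0] by simp
next
  case (Suc d)
  let ?N = "smult (coeff q (Suc d)) (newton_poly m t (Suc d))"
  have "degree (q - ?N) \<le> d"
  proof (rule degree_le, intro allI impI)
    fix i assume "d < i"
    then consider "i = Suc d" | "Suc d < i" by linarith
    then show "coeff (q - ?N) i = 0"
      using Suc.prems(1)
      by cases (auto simp: coeff_newton_poly coeff_eq_0 degree_newton_poly)
  qed
  then have "L (q - ?N) = M (q - ?N)"
    using Suc by auto
  moreover have "L ?N = M ?N"
    using Suc.prems(2) smult by simp
  moreover have "q = (q - ?N) + ?N" by simp
  ultimately show ?case using add by metis
qed

section \<open>Exactness of the two error operators\<close>

lemma deriv_poly: "deriv (poly q) (x :: real) = poly (pderiv q) x"
  by (rule DERIV_imp_deriv) (rule poly_DERIV)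

lemma fbdf_alpha_exact:
  fixes q :: "real poly"
  assumes m: "m = p + 1" and inj: "inj_on t {0..m}" and deg: "degree q \<le> m"
  shows "(\<Sum>i=0..m. fbdf_alpha p t i * poly q (t i)) = poly (pderiv q) (t m)"
proof (rule linear_functional_newton_eq[where d = m and m = m and t = t and q = q
      and L = "\<lambda>q. \<Sum>i=0..m. fbdf_alpha p t i * poly q (t i)"
      and M = "\<lambda>q. poly (pderiv q) (t m)"])
  fix k assume k: "k \<le> m"
  have "(\<Sum>i=0..m. fbdf_alpha p t i * poly (newton_poly m t k) (t i))
      = (\<Sum>j=1..p+1. (\<Prod>i=1..j-1. t m - t (m - i)) *
           delta m t j (\<lambda>i. poly (newton_poly m t k) (t i)))"
    using fbdf_alpha_sum[OF m, where y = "\<lambda>i. poly (newton_poly m t k) (t i)"] by simp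
  \<comment> \<open>Only the weight with \<open>j = k\<close> remains. For \<open>k = 0\<close> the
    sum is zero, as is the derivative of a constant.\<close>
  also have "\<dots> = (\<Sum>j=1..p+1. if j = k then \<Prod>i=1..j-1. t m - t (m - i) else 0)"
    using inj by (intro sum.cong refl) (simp add: delta_newton_poly m)
  also have "\<dots> = poly (pderiv (newton_poly m t k)) (t m)"
    using k m by (cases k) (simp_all add: pderiv_newton_poly_last)
  finally show "(\<Sum>i=0..m. fbdf_alpha p t i * poly (newton_poly m t k) (t i))
      = poly (pderiv (newton_poly m t k)) (t m)" .
qed (use deg in \<open>simp_all add: pderiv_add pderiv_smult algebra_simps sum.distrib sum_distrib_left\<close>)

text \<open>The product of \<open>fbdf_eta\<close> with the last coefficient is the share of the
  term \<open>j = m\<close> in the sum of inverse gaps. The other terms are positive and exist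
  because \<open>p \<ge> 1\<close>, so the share is below \<open>1\<close> and the quotient is
  positive.\<close>

lemma fbdf_filter_factor_nonzero:
  assumes m: "m = p + 1" and p: "p \<ge> 1" and mono: "strict_mono_on {0..m} t"
  shows "fbdf_eta p t / (1 - fbdf_eta p t * delta_coeff m t (p+1) m) \<noteq> 0"
proof -
  define P where "P j = (\<Prod>i=1..j. t m - t (m - i))" for j
  define S where "S k = (\<Sum>j=1..k. inverse (t m - t (m - j)))" for k
  have gap: "t m - t (m - i) > 0" if "i \<in> {1..m}" for i
    using strict_mono_onD[OF mono, of "m - i" m] that by auto
  have Pp: "P p > 0"
    unfolding P_def using gap m by (intro prod_pos) auto
  have Sp: "S p > 0"
    unfolding S_def using gap m p by (intro sum_pos) auto
  have g: "t m - t 0 > 0" using gap[of m] m by simp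
  have S: "S m = S p + inverse (t m - t 0)" by (simp add: S_def m)
  have eta: "fbdf_eta p t = P p / S m"
    by (simp add: fbdf_eta_def Let_def P_def S_def m)
  have c: "delta_coeff m t (p+1) m = inverse (P p * (t m - t 0))"
    using delta_coeff_last[of m m t] by (simp add: P_def m)
  have Sm: "S m > 0" using S Sp g by (simp add: add_pos_pos)
  have "fbdf_eta p t * delta_coeff m t (p+1) m = inverse (t m - t 0) / S m"
    unfolding eta c using Pp Sm g by (simp add: divide_simps)
  also have "\<dots> < 1" using Sm S Sp by simp
  finally show ?thesis using eta Pp Sm by simp
qed

lemma exactness_degreeI:
  assumes "vanishes_upto L (int d)" "degree q = Suc d" "L (poly q) \<noteq> 0"
  shows "exactness_degree L (int d)"
  unfolding exactness_degree_def
proof (intro conjI allI impI)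
  fix d' assume "vanishes_upto L d'"
  with assms have "\<not> int (Suc d) \<le> d'"
    unfolding vanishes_upto_def by metis
  then show "d' \<le> int d" by simp
qed fact

lemma fbdf_diff_exactness_degree:
  assumes m: "m = p + 1" and p: "p \<ge> 1" and mono: "strict_mono_on {0..m} t"
  shows "exactness_degree (diff_error m (fbdf_alpha p t) (fbdf_beta p t) t) (int m)"
proof (rule exactness_degreeI)
  have L: "diff_error m (fbdf_alpha p t) (fbdf_beta p t) t (poly q)
      = (\<Sum>i=0..m. fbdf_alpha p t i * poly q (t i)) - poly (pderiv q) (t m)" for q
    by (simp add: diff_error_def fbdf_beta_nodes[OF m p mono] deriv_poly)
  have inj: "inj_on t {0..m}"
    using mono by (rule strict_mono_on_imp_inj_on)
  show "vanishes_upto (diff_error m (fbdf_alpha p t) (fbdf_beta p t) t) (int m)"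
    by (simp add: vanishes_upto_def L fbdf_alpha_exact[OF m inj])
  let ?q = "newton_poly m t (Suc m)"
  show "degree ?q = Suc m" by (rule degree_newton_poly)
  have "(\<Sum>i=0..m. fbdf_alpha p t i * poly ?q (t i)) = 0"
    by (simp add: newton_poly_node)
  moreover have "(\<Prod>i=1..m. t m - t (m - i)) \<noteq> 0"
    using strict_mono_onD[OF mono] by (intro less_imp_neq[THEN not_sym] prod_pos) auto
  ultimately show "diff_error m (fbdf_alpha p t) (fbdf_beta p t) t (poly ?q) \<noteq> 0"
    by (simp add: L pderiv_newton_poly_last)
qed

lemma fbdf_interp_exactness_degree:
  assumes m: "m = p + 1" and p: "p \<ge> 1" and mono: "strict_mono_on {0..m} t"
  shows "exactness_degree (interp_error m (fbdf_beta p t) t) (int p)"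
proof (rule exactness_degreeI)
  define \<kappa> where "\<kappa> = fbdf_eta p t / (1 - fbdf_eta p t * delta_coeff m t (p+1) m)"
  have inj: "inj_on t {0..m}"
    using mono by (rule strict_mono_on_imp_inj_on)
  \<comment> \<open>The point of evaluation is \<open>t m\<close>, so its value cancels and only the
    filter term remains.\<close>
  have L: "interp_error m (fbdf_beta p t) t (poly q) = \<kappa> * coeff q m"
    if "degree q \<le> m" for q
    unfolding interp_error_def fbdf_beta_nodes[OF m p mono] \<kappa>_def
    using fbdf_beta_sum[OF m refl, of t "\<lambda>i. poly q (t i)"] delta_poly[OF inj order_refl that]
    by (simp add: m)
  show "vanishes_upto (interp_error m (fbdf_beta p t) t) (int p)"
    unfolding vanishes_upto_def using L m by (simp add: coeff_eq_0)
  show "degree (newton_poly m t m) = Suc p"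
    by (simp add: degree_newton_poly m)
  show "interp_error m (fbdf_beta p t) t (poly (newton_poly m t m)) \<noteq> 0"
    using fbdf_filter_factor_nonzero[OF m p mono]
    by (simp add: L degree_newton_poly coeff_newton_poly \<kappa>_def)
qed

theorem theorem3p2:
  fixes p m n :: nat and t :: "nat \<Rightarrow> real"
  assumes "p \<ge> 1" and "m = p + 1"
    and "strict_mono_on {n..n+m} t"
  shows "one_leg_order m (fbdf_alpha p (\<lambda>i. t (n + i))) (fbdf_beta p (\<lambda>i. t (n + i)))
           (\<lambda>i. t (n + i)) (int p + 1)"
proof -
  have mono: "strict_mono_on {0..m} (\<lambda>i. t (n + i))"
    using assms(3) by (auto simp: strict_mono_on_def)
  \<comment> \<open>Both entries of the minimum equal \<open>p + 1\<close>: the first is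
    \<open>m\<close>, the second \<open>p\<close> plus one.\<close>
  show ?thesis
    unfolding one_leg_order_def
    using fbdf_diff_exactness_degree[OF assms(2,1) mono]
      fbdf_interp_exactness_degree[OF assms(2,1) mono] assms(2)
    by (intro exI[of _ "int m"] exI[of _ "int p"]) simp
qed

end
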